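(* For every nonnegative integer $n$: let $LG_2(n)$ denote the number of partitions of $n$ into parts at least $2$ in which any two consecutive parts differ by at least $2$, and by at least $4$ if both are odd. Let $LG_{-2}(n)$ denote the number of signed partitions of $n$ in which the positive parts are odd and each at least $2\ell^+$, and the negative parts are odd, distinct and each at most $2\ell^+$. Let $LG'_{-2}(n)$ denote the number of signed partitions of $n$ in which the positive parts are at least $3$, odd and differ pairwise by at least $4$, and the negative parts are odd, distinct and each at most $2\ell^+-1$. Here $\ell^+$ is the number of positive parts of the signed partition. Then $LG_2(n)=LG_{-2}(n)=LG'_{-2}(n)$ for all $n\ge 0$.
   Context: A partition of an integer $n$ is a finite nonincreasing sequence of positive integers (its parts) summing to $n$. A signed partition of an integer $n$ is a pair $(\pi,\nu)$ of ordinary partitions with $|\pi|-|\nu|=n$, where $|\cdot|$ denotes the sum of parts; the parts of $\pi$ are the positive parts and the parts of $\nu$ are the negative parts (their sizes). $\ell^+$ denotes the number of positive parts of a signed partition. *)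

theory Defs
  imports Main
begin

definition is_partition :: "nat list \<Rightarrow> bool" where
  "is_partition xs \<longleftrightarrow> sorted_wrt (\<ge>) xs \<and> (\<forall>x\<in>set xs. 0 < x)"

definition partitions_of :: "nat \<Rightarrow> nat list set" where
  "partitions_of n = {xs. is_partition xs \<and> sum_list xs = n}"

text \<open>The second component lists the sizes of the negative parts, so its entries are positive.\<close>

definition signed_partitions_of :: "int \<Rightarrow> (nat list \<times> nat list) set" where
  "signed_partitions_of n =
    {(\<pi>, \<nu>). is_partition \<pi> \<and> is_partition \<nu> \<and> int (sum_list \<pi>) - int (sum_list \<nu>) = n}"

definition LG2 :: "nat \<Rightarrow> nat" where
  "LG2 n = card {xs \<in> partitions_of n.
     (\<forall>x\<in>set xs. 2 \<le> x) \<and>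
     (\<forall>i. Suc i < length xs \<longrightarrow>
        xs ! Suc i + 2 \<le> xs ! i \<and>
        (odd (xs ! i) \<and> odd (xs ! Suc i) \<longrightarrow> xs ! Suc i + 4 \<le> xs ! i))}"

definition LG_minus2 :: "nat \<Rightarrow> nat" where
  "LG_minus2 n = card {(\<pi>, \<nu>) \<in> signed_partitions_of (int n).
     (\<forall>x\<in>set \<pi>. odd x \<and> 2 * length \<pi> \<le> x) \<and>
     (\<forall>y\<in>set \<nu>. odd y \<and> y \<le> 2 * length \<pi>) \<and> distinct \<nu>}"

text \<open>The bound on the negative parts is stated over the integers, where
  \<open>2 * length \<pi> - 1\<close> does not truncate for empty \<open>\<pi>\<close>.\<close>

definition LG_minus2' :: "nat \<Rightarrow> nat" where
  "LG_minus2' n = card {(\<pi>, \<nu>) \<in> signed_partitions_of (int n).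
     (\<forall>x\<in>set \<pi>. odd x \<and> 3 \<le> x) \<and> sorted_wrt (\<lambda>x y. y + 4 \<le> x) \<pi> \<and>
     (\<forall>y\<in>set \<nu>. odd y \<and> int y \<le> 2 * int (length \<pi>) - 1) \<and> distinct \<nu>}"

end

theory Submission
  imports Defs
begin

text \<open>All three kinds of objects with \<open>k\<close> (positive) parts are parametrised by a weakly
  decreasing list \<open>ls\<close> of \<open>k\<close> even numbers together with a subset of \<open>{1, \<dots>, k}\<close>, given by
  its indicator \<open>bs\<close>.  For signed partitions, add \<open>2k + 1\<close> to every entry of \<open>ls\<close>,
  respectively the staircase \<open>4k - 1, \<dots>, 7, 3\<close> of the same total, and let the negative parts be
  the \<open>2j - 1\<close> with \<open>j\<close> outside the subset.  For the gap partitions, add the staircase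
  \<open>2k, \<dots>, 4, 2\<close> and, for each \<open>j\<close> in the subset, add \<open>1\<close> to the \<open>j\<close>-th part and \<open>2\<close> to
  each of the \<open>j - 1\<close> larger ones; the odd parts then record the subset.  The weights agree
  because the odd numbers \<open>1, 3, \<dots>, 2k - 1\<close> sum to \<open>k\<^sup>2\<close>.\<close>

section \<open>The encoding and the encoded families\<close>

definition even_lists :: "nat list set" where
  "even_lists = {ls. sorted_wrt (\<ge>) ls \<and> (\<forall>l\<in>set ls. even l)}"

definition marked_even_lists :: "(nat list \<times> bool list) set" where
  "marked_even_lists = {(ls, bs). ls \<in> even_lists \<and> length bs = length ls}"

text \<open>Position \<open>i\<close>, counted from 0, stands for \<open>2 * i + 1\<close>; the 1 is
  put last so that the list decreases.\<close>

fun omitted_odds :: "bool list \<Rightarrow> nat list" where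
  "omitted_odds [] = []"
| "omitted_odds (b # bs) = map (\<lambda>y. y + 2) (omitted_odds bs) @ (if b then [] else [1])"

fun stair4 :: "nat list \<Rightarrow> nat list" where
  "stair4 [] = []"
| "stair4 (l # ls) = (l + 4 * length ls + 3) # stair4 ls"

text \<open>Each part collects 2 from every mark to its right. The last clause also gives a default
  for lists of unequal length, which \<open>marked_even_lists\<close> excludes.\<close>

fun gap_parts :: "nat list \<Rightarrow> bool list \<Rightarrow> nat list" where
  "gap_parts (l # ls) (b # bs) =
    (l + 2 * Suc (length ls) + of_bool b + 2 * count_list bs True) # gap_parts ls bs"
| "gap_parts _ _ = []"

definition gap_rel :: "nat \<Rightarrow> nat \<Rightarrow> bool" where
  "gap_rel x y \<longleftrightarrow> y + 2 \<le> x \<and> (odd x \<and> odd y \<longrightarrow> y + 4 \<le> x)"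

definition gap_partitions :: "nat list set" where
  "gap_partitions = {xs. successively gap_rel xs \<and> (\<forall>x\<in>set xs. 2 \<le> x)}"

text \<open>An odd number never equals \<open>2 * k\<close>, so this bound serves both families of
  negative parts, also for \<open>k = 0\<close>.\<close>

definition odd_strict :: "nat \<Rightarrow> nat list set" where
  "odd_strict k = {\<nu>. sorted_wrt (>) \<nu> \<and> (\<forall>y\<in>set \<nu>. odd y \<and> y < 2 * k)}"

definition odd_large :: "nat list set" where
  "odd_large = {\<pi>. sorted_wrt (\<ge>) \<pi> \<and> (\<forall>x\<in>set \<pi>. odd x \<and> 2 * length \<pi> \<le> x)}"

definition odd_gap4 :: "nat list set" where
  "odd_gap4 = {\<pi>. sorted_wrt (\<lambda>x y. y + 4 \<le> x) \<pi> \<and> (\<forall>x\<in>set \<pi>. odd x \<and> 3 \<le> x)}"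

section \<open>Subsets of positions as sets of odd numbers\<close>

lemma set_omitted_odds: "set (omitted_odds bs) = {2 * i + 1 |i. i < length bs \<and> \<not> bs ! i}"
proof (induction bs)
  case (Cons b bs)
  have "{2 * i + 1 |i. i < length (b # bs) \<and> \<not> (b # bs) ! i} =
      (if b then {} else {1}) \<union> (\<lambda>y. y + 2) ` {2 * i + 1 |i. i < length bs \<and> \<not> bs ! i}"
    (is "?L = ?R")
  proof
    show "?L \<subseteq> ?R" by (auto simp: less_Suc_eq_0_disj)
    show "?R \<subseteq> ?L"
    proof
      fix y assume "y \<in> ?R"
      then consider "\<not> b" "y = 1" | i where "i < length bs" "\<not> bs ! i" "y = 2 * i + 1 + 2"
        by (auto split: if_splits)
      then show "y \<in> ?L"
      proof cases
        case 1
        then show ?thesis by (intro CollectI exI[of _ 0]) simp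
      next
        case (2 i)
        then show ?thesis by (intro CollectI exI[of _ "Suc i"]) simp
      qed
    qed
  qed
  with Cons show ?case by auto
qed simp

lemma sorted_omitted_odds: "sorted_wrt (>) (omitted_odds bs)"
  by (induction bs) (auto simp: sorted_wrt_append sorted_wrt_map)

lemma sorted_wrt_greater_unique:
  fixes xs ys :: "nat list"
  assumes "sorted_wrt (>) xs" "sorted_wrt (>) ys" "set xs = set ys"
  shows "xs = ys"
proof -
  have "rev xs = rev ys"
    by (rule strict_sorted_equal) (use assms in \<open>auto simp: sorted_wrt_rev\<close>)
  then show ?thesis by simp
qed

text \<open>A strictly decreasing list is determined by its set, and the odd numbers below
  \<open>2 * k\<close> are the \<open>2 * i + 1\<close> with \<open>i < k\<close>. So the mark at
  \<open>i\<close> is recovered as the absence of \<open>2 * i + 1\<close>.\<close>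

lemma bij_omitted_odds: "bij_betw omitted_odds {bs. length bs = k} (odd_strict k)"
proof (rule bij_betw_imageI)
  show "inj_on omitted_odds {bs. length bs = k}"
  proof (rule inj_onI)
    fix as bs assume *: "as \<in> {bs. length bs = k}" "bs \<in> {bs. length bs = k}"
      "omitted_odds as = omitted_odds bs"
    have "as ! i = bs ! i" if "i < k" for i
    proof -
      have "2 * i + 1 \<in> set (omitted_odds as) \<longleftrightarrow> \<not> as ! i"
        using * that unfolding set_omitted_odds by auto
      moreover have "2 * i + 1 \<in> set (omitted_odds bs) \<longleftrightarrow> \<not> bs ! i"
        using * that unfolding set_omitted_odds by auto
      ultimately show ?thesis using * by simp
    qed
    with * show "as = bs" by (auto intro: nth_equalityI)
  qed
  show "omitted_odds ` {bs. length bs = k} = odd_strict k"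
  proof
    show "omitted_odds ` {bs. length bs = k} \<subseteq> odd_strict k"
      by (auto simp: odd_strict_def sorted_omitted_odds set_omitted_odds)
    show "odd_strict k \<subseteq> omitted_odds ` {bs. length bs = k}"
    proof
      fix \<nu> assume \<nu>: "\<nu> \<in> odd_strict k"
      let ?bs = "map (\<lambda>i. 2 * i + 1 \<notin> set \<nu>) [0..<k]"
      have "set (omitted_odds ?bs) = set \<nu>"
        using \<nu> by (auto simp: set_omitted_odds odd_strict_def elim!: oddE)
      then have "omitted_odds ?bs = \<nu>"
        using \<nu> by (intro sorted_wrt_greater_unique) (auto simp: odd_strict_def sorted_omitted_odds)
      then show "\<nu> \<in> omitted_odds ` {bs. length bs = k}"
        by (intro image_eqI[of _ _ ?bs]) auto
    qed
  qed
qed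

section \<open>Positive parts from even lists\<close>

lemma even_lists_Cons:
  "l # ls \<in> even_lists \<longleftrightarrow> even l \<and> (ls = [] \<or> hd ls \<le> l) \<and> ls \<in> even_lists"
  by (cases ls) (auto simp: even_lists_def)

lemma length_stair4 [simp]: "length (stair4 ls) = length ls"
  by (induction ls) auto

lemma odd_gap4_Cons:
  "x # xs \<in> odd_gap4 \<longleftrightarrow> odd x \<and> 3 \<le> x \<and> (xs = [] \<or> hd xs + 4 \<le> x) \<and> xs \<in> odd_gap4"
  by (cases xs) (auto simp: odd_gap4_def)

text \<open>The steps of the staircase are odd, at least 3 and 4 apart: they turn even entries into
  odd ones and weak decrease into gaps of at least 4.\<close>

lemma bij_stair4: "bij_betw stair4 even_lists odd_gap4"
proof (rule bij_betw_imageI)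
  have "ls = ms" if "stair4 ls = stair4 ms" for ls ms
    using that
  proof (induction ls arbitrary: ms)
    case Nil then show ?case by (cases ms) auto
  next
    case (Cons l ls)
    then obtain m ms' where ms: "ms = m # ms'" by (cases ms) auto
    with Cons.prems have "stair4 ls = stair4 ms'" by simp
    with Cons.IH have "ls = ms'" .
    with Cons.prems ms show ?case by simp
  qed
  then show "inj_on stair4 even_lists" by (auto intro: inj_onI)
  have "stair4 ls \<in> odd_gap4" if "ls \<in> even_lists" for ls
    using that
  proof (induction ls)
    case (Cons l ls)
    then show ?case by (cases ls) (auto simp: even_lists_Cons odd_gap4_Cons)
  qed (simp add: odd_gap4_def)
  moreover have "\<exists>ls\<in>even_lists. stair4 ls = xs" if "xs \<in> odd_gap4" for xs
    using that
  proof (induction xs)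
    case Nil
    then show ?case by (intro bexI[of _ "[]"]) (auto simp: even_lists_def)
  next
    case (Cons x xs)
    then obtain ls where ls: "ls \<in> even_lists" "stair4 ls = xs"
      by (auto simp: odd_gap4_Cons)
    \<comment> \<open>The head of a nonempty \<open>xs\<close> is \<open>hd ls\<close> plus its own
      stair step, and the gap of 4 lifts this to the next step. The first bound makes the
      subtraction in the witness exact, the second keeps the list decreasing.\<close>
    have bound: "4 * length ls + 3 \<le> x" "ls = [] \<or> hd ls + (4 * length ls + 3) \<le> x"
      using Cons.prems ls(2) by (cases ls; auto simp: odd_gap4_Cons)+
    moreover have "odd x" using Cons.prems by (simp add: odd_gap4_Cons)
    ultimately show ?case using ls
      by (intro bexI[of _ "(x - (4 * length ls + 3)) # ls"]) (auto simp: even_lists_Cons)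
  qed
  ultimately show "stair4 ` even_lists = odd_gap4" by auto
qed

lemma bij_shift:
  "bij_betw (\<lambda>ls. map (\<lambda>l. l + (2 * length ls + 1)) ls) even_lists odd_large"
proof (rule bij_betw_byWitness[where f' = "\<lambda>xs. map (\<lambda>x. x - (2 * length xs + 1)) xs"])
  \<comment> \<open>An odd part cannot equal the even bound. This gains the 1 that makes subtracting
    \<open>2 * length \<pi> + 1\<close> exact.\<close>
  have large: "2 * length \<pi> + 1 \<le> x" if "\<pi> \<in> odd_large" "x \<in> set \<pi>" for \<pi> x
  proof -
    have "odd x" "2 * length \<pi> \<le> x" using that by (auto simp: odd_large_def)
    then show ?thesis by (cases "x = 2 * length \<pi>") auto
  qed
  show "\<forall>ls\<in>even_lists. map (\<lambda>x. x - (2 * length (map (\<lambda>l. l + (2 * length ls + 1)) ls) + 1))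
      (map (\<lambda>l. l + (2 * length ls + 1)) ls) = ls"
    by (simp add: o_def)
  show "\<forall>\<pi>\<in>odd_large. map (\<lambda>l. l + (2 * length (map (\<lambda>x. x - (2 * length \<pi> + 1)) \<pi>) + 1))
      (map (\<lambda>x. x - (2 * length \<pi> + 1)) \<pi>) = \<pi>"
    using large by (auto intro!: map_idI simp del: One_nat_def)
  show "(\<lambda>ls. map (\<lambda>l. l + (2 * length ls + 1)) ls) ` even_lists \<subseteq> odd_large"
    by (auto simp: even_lists_def odd_large_def sorted_wrt_map)
  show "(\<lambda>xs. map (\<lambda>x. x - (2 * length xs + 1)) xs) ` odd_large \<subseteq> even_lists"
  proof clarify
    fix \<pi> assume \<pi>: "\<pi> \<in> odd_large"
    have "even (x - (2 * length \<pi> + 1))" if "x \<in> set \<pi>" for x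
      using \<pi> that large[OF \<pi> that] by (auto simp: odd_large_def)
    moreover have "sorted_wrt (\<ge>) (map (\<lambda>x. x - (2 * length \<pi> + 1)) \<pi>)"
      using \<pi> unfolding sorted_wrt_map odd_large_def
      by (auto elim!: sorted_wrt_mono_rel[rotated] intro: diff_le_mono)
    ultimately show "map (\<lambda>x. x - (2 * length \<pi> + 1)) \<pi> \<in> even_lists"
      by (auto simp: even_lists_def)
  qed
qed

section \<open>Decoding gap partitions\<close>

lemma length_gap_parts [simp]: "length bs = length ls \<Longrightarrow> length (gap_parts ls bs) = length ls"
  by (induction ls bs rule: gap_parts.induct) auto

lemma gap_partitions_Cons:
  "x # xs \<in> gap_partitions \<longleftrightarrow>
    2 \<le> x \<and> (xs = [] \<or> gap_rel x (hd xs)) \<and> xs \<in> gap_partitions"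
  by (cases xs) (auto simp: gap_partitions_def)

text \<open>Once the tails agree, so do their contributions to the first part. What is left there is
  \<open>l + of_bool b\<close> with \<open>l\<close> even, and its parity reveals
  \<open>b\<close>.\<close>

lemma gap_parts_inj:
  assumes "length bs = length ls" "length cs = length ms"
    and "\<forall>l\<in>set ls. even l" "\<forall>m\<in>set ms. even m"
    and "gap_parts ls bs = gap_parts ms cs"
  shows "ls = ms \<and> bs = cs"
  using assms
proof (induction ls arbitrary: bs ms cs)
  case Nil then show ?case by (cases ms; cases cs) auto
next
  case (Cons l ls)
  from Cons.prems(1) obtain b bs' where bs: "bs = b # bs'" by (cases bs) auto
  have "length ms = length (l # ls)"
    using arg_cong[OF Cons.prems(5), of length] Cons.prems(1,2) by simp
  then obtain m ms' c cs' where ms: "ms = m # ms'" and cs: "cs = c # cs'"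
    using Cons.prems(2) by (cases ms; cases cs) auto
  have "gap_parts ls bs' = gap_parts ms' cs'"
    using Cons.prems(5) by (simp add: bs ms cs)
  then have eq: "ls = ms'" "bs' = cs'"
    using Cons.IH[of bs' cs' ms'] Cons.prems by (auto simp: bs ms cs)
  then have "l + of_bool b = m + of_bool c"
    using Cons.prems(5) by (simp add: bs ms cs)
  moreover from this have "b = c"
  proof -
    have "odd (l + of_bool b) \<longleftrightarrow> b" "odd (m + of_bool c) \<longleftrightarrow> c"
      using Cons.prems(3,4) by (simp_all add: ms)
    with \<open>l + of_bool b = m + of_bool c\<close> show ?thesis by simp
  qed
  ultimately show ?case using eq by (simp add: bs ms cs)
qed

text \<open>Neighbouring parts with entries \<open>l\<close>, \<open>l'\<close> and marks
  \<open>b\<close>, \<open>b'\<close> differ by \<open>l - l' + 2 + of_bool b + of_bool b'\<close>.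
  A part is odd exactly when marked, so two odd neighbours are at least 4 apart.\<close>

lemma gap_parts_in:
  assumes "ls \<in> even_lists" "length bs = length ls"
  shows "gap_parts ls bs \<in> gap_partitions"
  using assms(2,1)
proof (induction bs ls rule: list_induct2)
  case (Cons b bs l ls)
  then show ?case
    by (cases ls; cases bs; cases b; cases "hd bs")
       (auto simp: even_lists_Cons gap_partitions_Cons gap_rel_def)
qed (simp add: gap_partitions_def)

lemma gap_parts_surj:
  assumes "xs \<in> gap_partitions"
  shows "\<exists>ls bs. ls \<in> even_lists \<and> length bs = length ls \<and> gap_parts ls bs = xs"
  using assms
proof (induction xs)
  case Nil
  then show ?case by (auto simp: even_lists_def intro!: exI[of _ "[]"])
next
  case (Cons x xs)
  then obtain ls bs where ls: "ls \<in> even_lists" "length bs = length ls" "gap_parts ls bs = xs"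
    by (auto simp: gap_partitions_Cons)
  \<comment> \<open>\<open>d\<close> is what \<open>gap_parts\<close> adds to a new first entry
    whose mark is the parity of \<open>x\<close>, so that entry has to be
    \<open>x - d\<close>.\<close>
  define d where "d = 2 * Suc (length ls) + of_bool (odd x) + 2 * count_list bs True"
  have d: "d \<le> x \<and> (ls = [] \<or> hd ls + d \<le> x)"
  proof (cases ls)
    case Nil
    then show ?thesis using Cons.prems ls
      by (cases "x = 2") (auto simp: d_def gap_partitions_Cons)
  next
    case (Cons l ls')
    with ls obtain b bs' where bs: "bs = b # bs'" by (cases bs) auto
    have xs: "hd xs = l + 2 * Suc (length ls') + of_bool b + 2 * count_list bs' True" "xs \<noteq> []"
      using ls(3) Cons bs by auto
    have "even l" using ls(1) Cons by (simp add: even_lists_Cons)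
    then have par: "odd (hd xs) \<longleftrightarrow> b" by (simp add: xs)
    have rel: "gap_rel x (hd xs)"
      using Cons.prems xs(2) by (simp add: gap_partitions_Cons)
    have "l + d \<le> x"
    \<comment> \<open>The claim amounts to \<open>x - hd xs\<close> being at least 2 plus the number
      of odd values among \<open>x\<close> and \<open>hd xs\<close>. For equal parities this is the
      gap condition; unequal parities rule out a difference of exactly 2.\<close>
    proof (cases "b \<longleftrightarrow> odd x")
      case True
      then show ?thesis using rel par
        by (cases b) (auto simp: gap_rel_def d_def bs xs(1) Cons)
    next
      case False
      then have "x \<noteq> hd xs + 2" using par by auto
      then have "hd xs + 3 \<le> x" using rel by (auto simp: gap_rel_def)
      then show ?thesis using False
        by (cases b) (auto simp: d_def bs xs(1) Cons)
    qed
    then show ?thesis by (simp add: Cons)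
  qed
  have "even (x - d)" using d by (auto simp: d_def)
  with d ls have "(x - d) # ls \<in> even_lists" "gap_parts ((x - d) # ls) (odd x # bs) = x # xs"
    by (auto simp: even_lists_Cons d_def)
  then show ?case using ls(2) by (intro exI[of _ "(x - d) # ls"] exI[of _ "odd x # bs"]) simp
qed

section \<open>Bijections from marked even lists\<close>

lemma bij_gap_parts: "bij_betw (\<lambda>(ls, bs). gap_parts ls bs) marked_even_lists gap_partitions"
proof (rule bij_betw_imageI)
  show "inj_on (\<lambda>(ls, bs). gap_parts ls bs) marked_even_lists"
  proof (rule inj_onI, clarify)
    fix ls bs ms cs
    assume "(ls, bs) \<in> marked_even_lists" "(ms, cs) \<in> marked_even_lists"
      "gap_parts ls bs = gap_parts ms cs"
    then show "ls = ms \<and> bs = cs"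
      by (intro gap_parts_inj) (auto simp: marked_even_lists_def even_lists_def)
  qed
  show "(\<lambda>(ls, bs). gap_parts ls bs) ` marked_even_lists = gap_partitions"
    using gap_parts_in gap_parts_surj by (force simp: marked_even_lists_def)
qed

text \<open>Handles both signed families at once. The bound on the negative parts depends on
  \<open>length \<pi>\<close>; as \<open>f\<close> preserves length, this is the number of
  marks.\<close>

lemma bij_signed:
  assumes f: "bij_betw f even_lists X" and len: "\<And>ls. length (f ls) = length ls"
  shows "bij_betw (\<lambda>(ls, bs). (f ls, omitted_odds bs)) marked_even_lists
           {(\<pi>, \<nu>). \<pi> \<in> X \<and> \<nu> \<in> odd_strict (length \<pi>)}"
proof (rule bij_betw_imageI)
  show "inj_on (\<lambda>(ls, bs). (f ls, omitted_odds bs)) marked_even_lists"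
  proof (rule inj_onI, clarify)
    fix ls bs ms cs
    assume *: "(ls, bs) \<in> marked_even_lists" "(ms, cs) \<in> marked_even_lists"
      "f ls = f ms" "omitted_odds bs = omitted_odds cs"
    then have "ls = ms"
      using f by (auto simp: marked_even_lists_def bij_betw_def dest: inj_onD)
    then show "ls = ms \<and> bs = cs"
      using * bij_omitted_odds[of "length ls"]
      by (auto simp: marked_even_lists_def bij_betw_def dest: inj_onD)
  qed
  show "(\<lambda>(ls, bs). (f ls, omitted_odds bs)) ` marked_even_lists =
      {(\<pi>, \<nu>). \<pi> \<in> X \<and> \<nu> \<in> odd_strict (length \<pi>)}" (is "?L = ?R")
  proof
    show "?L \<subseteq> ?R"
      using f bij_betwE[OF bij_omitted_odds] by (auto simp: marked_even_lists_def len bij_betw_def)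
    show "?R \<subseteq> ?L"
    proof clarify
      fix \<pi> \<nu> assume *: "\<pi> \<in> X" "\<nu> \<in> odd_strict (length \<pi>)"
      then obtain ls where ls: "ls \<in> even_lists" "f ls = \<pi>"
        using f by (auto simp: bij_betw_def)
      have "\<nu> \<in> omitted_odds ` {bs. length bs = length \<pi>}"
        using *(2) by (simp add: bij_betw_imp_surj_on[OF bij_omitted_odds])
      then obtain bs where "length bs = length \<pi>" "omitted_odds bs = \<nu>"
        by blast
      with ls len show "(\<pi>, \<nu>) \<in> ?L"
        by (intro image_eqI[of _ _ "(ls, bs)"]) (auto simp: marked_even_lists_def)
    qed
  qed
qed

section \<open>Comparison of weights\<close>

lemma length_omitted_odds: "length (omitted_odds bs) + count_list bs True = length bs"
  by (induction bs) auto

text \<open>Let \<open>bs\<close> have length \<open>k\<close> with \<open>c\<close> marks.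
  Prepending \<open>l\<close> and \<open>b\<close> adds
  \<open>l + 2 * (k + 1) + of_bool b + 2 * c\<close> on the gap side. The omitted numbers gain
  \<open>2 * (k - c)\<close>, and 1 more if \<open>b\<close> is false. Together this is
  \<open>l + 4 * k + 3\<close>, the new entry of \<open>stair4\<close>.\<close>

lemma sum_gap_parts:
  "length bs = length ls \<Longrightarrow>
    sum_list (gap_parts ls bs) + sum_list (omitted_odds bs) = sum_list (stair4 ls)"
proof (induction bs ls rule: list_induct2)
  case (Cons b bs l ls)
  have "sum_list (map (\<lambda>y. y + 2) ys) = sum_list ys + 2 * length ys" for ys :: "nat list"
    by (induction ys) auto
  then show ?case using Cons length_omitted_odds[of bs] by auto
qed simp

text \<open>For \<open>k\<close> entries the steps 3, 7, ..., \<open>4 * k - 1\<close> have average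
  \<open>2 * k + 1\<close>.\<close>

lemma sum_stair4: "sum_list (stair4 ls) = sum_list (map (\<lambda>l. l + (2 * length ls + 1)) ls)"
proof -
  have "sum_list (stair4 ls) = sum_list ls + length ls * (2 * length ls + 1)"
    by (induction ls) (auto simp: algebra_simps)
  moreover have "sum_list (map (\<lambda>l. l + c) ls) = sum_list ls + length ls * c" for c
    by (induction ls) auto
  ultimately show ?thesis by metis
qed

section \<open>Counting objects of fixed weight\<close>

lemma card_bij_weight:
  assumes "bij_betw f A B" and "\<And>x. x \<in> A \<Longrightarrow> P x \<longleftrightarrow> Q (f x)"
  shows "card {x \<in> A. P x} = card {y \<in> B. Q y}"
proof -
  have "f ` {x \<in> A. P x} = {y \<in> B. Q y}"
    using assms by (auto simp: bij_betw_def)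
  then show ?thesis
    using assms by (metis (no_types, lifting) bij_betw_imp_inj_on card_image inj_on_subset
        mem_Collect_eq subsetI)
qed

text \<open>The right-hand side is the common value through which all three counts are
  compared.\<close>

lemma LG2_eq:
  "LG2 n = card {p \<in> marked_even_lists. sum_list (gap_parts (fst p) (snd p)) = n}"
proof -
  \<comment> \<open>The gap condition on neighbours already forces the global order that
    \<open>is_partition\<close> demands.\<close>
  have "sorted_wrt (\<ge>) xs" if "successively gap_rel xs" for xs
  proof -
    have "successively (\<ge>) xs"
      using that by (rule successively_mono) (auto simp: gap_rel_def)
    then show ?thesis by (simp add: successively_conv_sorted_wrt transp_def)
  qed
  then have "{xs \<in> partitions_of n.
     (\<forall>x\<in>set xs. 2 \<le> x) \<and>
     (\<forall>i. Suc i < length xs \<longrightarrow>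
        xs ! Suc i + 2 \<le> xs ! i \<and>
        (odd (xs ! i) \<and> odd (xs ! Suc i) \<longrightarrow> xs ! Suc i + 4 \<le> xs ! i))} =
     {xs \<in> gap_partitions. sum_list xs = n}"
    by (fastforce simp: partitions_of_def is_partition_def gap_partitions_def
        successively_conv_nth gap_rel_def)
  then show ?thesis
    unfolding LG2_def using card_bij_weight[OF bij_gap_parts] by (auto simp: case_prod_unfold)
qed

lemma is_partition_odd:
  "\<forall>x\<in>set xs. odd x \<Longrightarrow> is_partition xs \<longleftrightarrow> sorted_wrt (\<ge>) xs"
  by (auto simp: is_partition_def intro: odd_pos)

lemma odd_strict_iff:
  "\<nu> \<in> odd_strict k \<longleftrightarrow>
    is_partition \<nu> \<and> (\<forall>y\<in>set \<nu>. odd y \<and> y \<le> 2 * k) \<and> distinct \<nu>"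
proof -
  have "odd y \<and> y \<le> 2 * k \<longleftrightarrow> odd y \<and> y < 2 * k" for y :: nat
    by (cases "y = 2 * k") auto
  then have "(\<forall>y\<in>set \<nu>. odd y \<and> y \<le> 2 * k) \<longleftrightarrow> (\<forall>y\<in>set \<nu>. odd y \<and> y < 2 * k)"
    by blast
  moreover have "sorted_wrt (>) \<nu> \<longleftrightarrow> sorted_wrt (\<ge>) \<nu> \<and> distinct \<nu>"
    using strict_sorted_iff[of "rev \<nu>"] by (simp add: sorted_wrt_rev)
  ultimately show ?thesis
    unfolding odd_strict_def mem_Collect_eq using is_partition_odd[of \<nu>] by blast
qed

lemma odd_large_iff:
  "\<pi> \<in> odd_large \<longleftrightarrow> is_partition \<pi> \<and> (\<forall>x\<in>set \<pi>. odd x \<and> 2 * length \<pi> \<le> x)"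
  unfolding odd_large_def mem_Collect_eq using is_partition_odd[of \<pi>] by blast

lemma odd_gap4_iff:
  "\<pi> \<in> odd_gap4 \<longleftrightarrow>
    is_partition \<pi> \<and> (\<forall>x\<in>set \<pi>. odd x \<and> 3 \<le> x) \<and> sorted_wrt (\<lambda>x y. y + 4 \<le> x) \<pi>"
proof -
  have "sorted_wrt (\<ge>) \<pi>" if "sorted_wrt (\<lambda>x y. y + 4 \<le> x) \<pi>"
    using that by (rule sorted_wrt_mono_rel[rotated]) auto
  then show ?thesis
    unfolding odd_gap4_def mem_Collect_eq using is_partition_odd[of \<pi>] by blast
qed

lemma mem_signed_partitions_of:
  "(\<pi>, \<nu>) \<in> signed_partitions_of (int n) \<longleftrightarrow>
    is_partition \<pi> \<and> is_partition \<nu> \<and> sum_list \<pi> = n + sum_list \<nu>"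
proof -
  have "int (sum_list \<pi>) - int (sum_list \<nu>) = int n \<longleftrightarrow> sum_list \<pi> = n + sum_list \<nu>"
    by linarith
  then show ?thesis by (simp add: signed_partitions_of_def)
qed

lemma LG_minus2_eq:
  "LG_minus2 n = card {p \<in> marked_even_lists. sum_list (gap_parts (fst p) (snd p)) = n}"
proof -
  have "{(\<pi>, \<nu>) \<in> signed_partitions_of (int n).
     (\<forall>x\<in>set \<pi>. odd x \<and> 2 * length \<pi> \<le> x) \<and>
     (\<forall>y\<in>set \<nu>. odd y \<and> y \<le> 2 * length \<pi>) \<and> distinct \<nu>} =
     {p \<in> {(\<pi>, \<nu>). \<pi> \<in> odd_large \<and> \<nu> \<in> odd_strict (length \<pi>)}.
       sum_list (fst p) = n + sum_list (snd p)}"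
    unfolding set_eq_iff split_paired_All mem_Collect_eq case_prod_conv mem_signed_partitions_of
      odd_strict_iff odd_large_iff fst_conv snd_conv by blast
  \<comment> \<open>By \<open>sum_gap_parts\<close> and \<open>sum_stair4\<close> the positive parts
    sum to the gap parts plus the negative parts, so cancelling the negative parts matches the two
    weight conditions.\<close>
  moreover have "card {p \<in> marked_even_lists. sum_list (gap_parts (fst p) (snd p)) = n} =
      card {p \<in> {(\<pi>, \<nu>). \<pi> \<in> odd_large \<and> \<nu> \<in> odd_strict (length \<pi>)}.
        sum_list (fst p) = n + sum_list (snd p)}"
    by (rule card_bij_weight[OF bij_signed[OF bij_shift]])
       (auto simp: marked_even_lists_def sum_stair4 dest!: sum_gap_parts)
  ultimately show ?thesis unfolding LG_minus2_def by simp
qed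

lemma LG_minus2'_eq:
  "LG_minus2' n = card {p \<in> marked_even_lists. sum_list (gap_parts (fst p) (snd p)) = n}"
proof -
  have bound: "(odd y \<and> int y \<le> 2 * int k - 1) \<longleftrightarrow> (odd y \<and> y \<le> 2 * k)" for y k :: nat
    by (cases "y = 2 * k") auto
  have "{(\<pi>, \<nu>) \<in> signed_partitions_of (int n).
     (\<forall>x\<in>set \<pi>. odd x \<and> 3 \<le> x) \<and> sorted_wrt (\<lambda>x y. y + 4 \<le> x) \<pi> \<and>
     (\<forall>y\<in>set \<nu>. odd y \<and> int y \<le> 2 * int (length \<pi>) - 1) \<and> distinct \<nu>} =
     {p \<in> {(\<pi>, \<nu>). \<pi> \<in> odd_gap4 \<and> \<nu> \<in> odd_strict (length \<pi>)}.
       sum_list (fst p) = n + sum_list (snd p)}"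
    unfolding bound
    unfolding set_eq_iff split_paired_All mem_Collect_eq case_prod_conv mem_signed_partitions_of
      odd_strict_iff odd_gap4_iff fst_conv snd_conv by blast
  moreover have "card {p \<in> marked_even_lists. sum_list (gap_parts (fst p) (snd p)) = n} =
      card {p \<in> {(\<pi>, \<nu>). \<pi> \<in> odd_gap4 \<and> \<nu> \<in> odd_strict (length \<pi>)}.
        sum_list (fst p) = n + sum_list (snd p)}"
    by (rule card_bij_weight[OF bij_signed[OF bij_stair4]])
       (auto simp: marked_even_lists_def dest!: sum_gap_parts)
  ultimately show ?thesis unfolding LG_minus2'_def by simp
qed

theorem theorem5p5:
  fixes n :: nat
  shows "LG2 n = LG_minus2 n \<and> LG_minus2 n = LG_minus2' n"
  by (simp add: LG2_eq LG_minus2_eq LG_minus2'_eq)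

end
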